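(* Let $P$ and $Q$ be probability distributions with the same support $\omega\subseteq\mathbb{R}^n$, with densities $p$ and $q$ with respect to $\lambda$. Let $f:\omega\to\mathbb{R}$ be a function such that $E_P, E_Q, V_P, V_Q$ are finite and $V_P, V_Q>0$, where $E_P=E_P[f]$, $E_Q=E_Q[f]$, $V_P=\mathrm{Var}_P(f)$, $V_Q=\mathrm{Var}_Q(f)$. Put $$A:=(E_Q-E_P)^2+V_P+V_Q,\qquad D:=\sqrt{A^2-4V_PV_Q}.$$ Then $$\mathrm{KL}(P\|Q)\ \ge\ \frac{A-2V_P}{D}\,\tanh^{-1}\!\Big(\frac{D}{A}\Big)+\frac12\log\frac{V_P}{V_Q},$$ where, if $D=0$, the first term on the right-hand side is read as $0$. Moreover, equality holds if and only if there exists a function $C:[0,1]\to\mathbb{R}$ such that $$\frac{q(x)-p(x)}{p(x)+t\,(q(x)-p(x))}=\bigl(f(x)-E_P-t(E_Q-E_P)\bigr)\,C(t)$$ for all $t\in[0,1]$ and ($\lambda$-almost) all $x\in\omega$.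
   Context: $\lambda$ denotes the Lebesgue measure or the counting measure, all integrals are over $\omega$, and $p,q$ are the Radon-Nikodym derivatives of $P,Q$ with respect to $\lambda$. That $P$ and $Q$ have the same support $\omega$ means that $p>0$ and $q>0$ ($\lambda$-almost everywhere) on $\omega$ and both are concentrated on $\omega$. The Kullback-Leibler divergence is $\mathrm{KL}(P\|Q):=\int p(x)\log\frac{p(x)}{q(x)}\,d\lambda(x)\in[0,\infty]$. For a (measurable) function $f:\omega\to\mathbb{R}$, $E_P[f]:=\int p(x)f(x)\,d\lambda(x)$ and $\mathrm{Var}_P(f):=E_P[f^2]-E_P[f]^2$, and similarly for $Q$. *)

theory Defs
  imports "HOL-Probability.Probability"
begin

text \<open>
  Lebesgue measure is admitted both on the Borel sets and on the completed sigma-algebra, so that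
  distributions and functions may be Borel or Lebesgue measurable.
\<close>
definition reference_measure :: "(real ^ 'n) measure \<Rightarrow> bool" where
  "reference_measure lam \<longleftrightarrow> lam = lborel \<or> lam = lebesgue \<or> lam = count_space UNIV"

definition distribution_with_density ::
    "(real ^ 'n) measure \<Rightarrow> (real ^ 'n) measure \<Rightarrow> (real ^ 'n \<Rightarrow> real) \<Rightarrow> bool" where
  "distribution_with_density lam P p \<longleftrightarrow>
     prob_space P \<and> p \<in> borel_measurable lam \<and> (AE x in lam. 0 \<le> p x) \<and>
     P = density lam (\<lambda>x. ennreal (p x))"

definition has_support ::
    "(real ^ 'n) measure \<Rightarrow> (real ^ 'n) measure \<Rightarrow> (real ^ 'n \<Rightarrow> real) \<Rightarrow> (real ^ 'n) set \<Rightarrow> bool" where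
  "has_support lam P p \<omega> \<longleftrightarrow>
     \<omega> \<in> sets lam \<and> (AE x in P. x \<in> \<omega>) \<and> (AE x\<in>\<omega> in lam. 0 < p x)"

text \<open>
  The library's \<open>KL_divergence\<close> is a Bochner integral, hence \<open>0\<close> rather than \<open>\<infinity>\<close> when
  the integrand is not integrable. Here the integral is the difference of the integrals of the
  positive and negative parts (\<^term>\<open>ennreal\<close> truncates negative reals to \<open>0\<close>). For probability
  densities the second integral is finite, because \<open>p ln (p / q) \<ge> p - q\<close>.
\<close>
definition KL ::
    "(real ^ 'n) measure \<Rightarrow> (real ^ 'n) set \<Rightarrow> (real ^ 'n \<Rightarrow> real) \<Rightarrow> (real ^ 'n \<Rightarrow> real) \<Rightarrow> ereal" where
  "KL lam \<omega> p q =
     enn2ereal (\<integral>\<^sup>+x\<in>\<omega>. ennreal (p x * ln (p x / q x)) \<partial>lam)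
     - enn2ereal (\<integral>\<^sup>+x\<in>\<omega>. ennreal (- (p x * ln (p x / q x))) \<partial>lam)"

definition mean ::
    "(real ^ 'n) measure \<Rightarrow> (real ^ 'n) set \<Rightarrow> (real ^ 'n \<Rightarrow> real) \<Rightarrow> (real ^ 'n \<Rightarrow> real) \<Rightarrow> real" where
  "mean lam \<omega> p f = (LINT x:\<omega>|lam. p x * f x)"

definition var ::
    "(real ^ 'n) measure \<Rightarrow> (real ^ 'n) set \<Rightarrow> (real ^ 'n \<Rightarrow> real) \<Rightarrow> (real ^ 'n \<Rightarrow> real) \<Rightarrow> real" where
  "var lam \<omega> p f = mean lam \<omega> p (\<lambda>x. (f x)\<^sup>2) - (mean lam \<omega> p f)\<^sup>2"

text \<open>
  Finiteness of mean and variance: the Bochner integrals above are junk values \<open>0\<close> without it.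
\<close>
definition finite_mean_var ::
    "(real ^ 'n) measure \<Rightarrow> (real ^ 'n) set \<Rightarrow> (real ^ 'n \<Rightarrow> real) \<Rightarrow> (real ^ 'n \<Rightarrow> real) \<Rightarrow> bool" where
  "finite_mean_var lam \<omega> p f \<longleftrightarrow>
     set_integrable lam \<omega> (\<lambda>x. p x * f x) \<and> set_integrable lam \<omega> (\<lambda>x. p x * (f x)\<^sup>2)"

end

theory Submission imports Defs begin

text \<open>
  Let \<open>r\<^sub>t = p + t (q - p)\<close>. Pointwise, \<open>p ln (p / q) + q - p\<close> is the integral over \<open>t\<close> in
  \<open>[0, 1]\<close> of \<open>t (q - p)\<^sup>2 / r\<^sub>t\<close>. For fixed \<open>t\<close> the Cauchy-Schwarz (Hammersley-Chapman-Robbins)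
  bound on the integral of \<open>(q - p)\<^sup>2 / r\<^sub>t\<close> over \<open>x\<close> is the integrated form of the tangent inequality
  \<open>u\<^sup>2 / r \<ge> 2 c u w - c\<^sup>2 w\<^sup>2 r\<close> with \<open>u = q - p\<close>, \<open>w = f - m\<^sub>t\<close> and \<open>c = (E\<^sub>Q - E\<^sub>P) / v\<^sub>t\<close>, where
  \<open>m\<^sub>t\<close> and \<open>v\<^sub>t\<close> are the mean and variance of \<open>f\<close> under \<open>r\<^sub>t\<close>. Since the right-hand side is linear in
  \<open>p, q, p f, q f, p f\<^sup>2, q f\<^sup>2\<close> with coefficients depending only on \<open>t\<close>, integrating it over \<open>t\<close>
  first and over \<open>x\<close> afterwards needs no Fubini theorem and leaves the integral of
  \<open>t (E\<^sub>Q - E\<^sub>P)\<^sup>2 / v\<^sub>t\<close>, which is elementary. The defect in the tangent inequality is a square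
  over \<open>r\<^sub>t\<close>, continuous in \<open>t\<close>, so equality forces it to vanish for every \<open>t\<close>.
\<close>

section \<open>Integrals over t at a single point x\<close>

text \<open>The integrand is linear in the six variables, with coefficients that are continuous in
  t. The numbers \<open>k0\<close>, ..., \<open>l2\<close> are fixed before \<open>a0\<close>, ...,
  \<open>b2\<close>, so one choice serves both the densities at every point x and the moments of f.
  This is what replaces an exchange of integrals.\<close>

lemma has_integral_tangent_form:
  fixes c m :: "real \<Rightarrow> real"
  assumes "continuous_on {0..1} c" "continuous_on {0..1} m"
  obtains k0 l0 k1 l1 k2 l2 where "\<And>a0 b0 a1 b1 a2 b2.
    ((\<lambda>t. t * (2 * c t * ((b1 - a1) - m t * (b0 - a0))
        - (c t)\<^sup>2 * (((1 - t) * a2 + t * b2) - 2 * m t * ((1 - t) * a1 + t * b1)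
                    + (m t)\<^sup>2 * ((1 - t) * a0 + t * b0))))
      has_integral (k0 * a0 + l0 * b0 + k1 * a1 + l1 * b1 + k2 * a2 + l2 * b2)) {0..1}"
proof -
  define I where "I g = integral {0..1} g" for g :: "real \<Rightarrow> real"
  define g1 where "g1 t = 2 * t * c t * m t - t * (1 - t) * (c t)\<^sup>2 * (m t)\<^sup>2" for t
  define g2 where "g2 t = - 2 * t * c t * m t - t\<^sup>2 * (c t)\<^sup>2 * (m t)\<^sup>2" for t
  define g3 where "g3 t = - 2 * t * c t + 2 * t * (1 - t) * (c t)\<^sup>2 * m t" for t
  define g4 where "g4 t = 2 * t * c t + 2 * t\<^sup>2 * (c t)\<^sup>2 * m t" for t
  define g5 where "g5 t = - t * (1 - t) * (c t)\<^sup>2" for t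
  define g6 where "g6 t = - t\<^sup>2 * (c t)\<^sup>2" for t
  note defs = g1_def g2_def g3_def g4_def g5_def g6_def
  have I: "(g has_integral I g) {0..1}" if "continuous_on {0..1} g" for g
    unfolding I_def by (intro integrable_integral integrable_continuous_real that)
  have h: "(g1 has_integral I g1) {0..1}" "(g2 has_integral I g2) {0..1}"
      "(g3 has_integral I g3) {0..1}" "(g4 has_integral I g4) {0..1}"
      "(g5 has_integral I g5) {0..1}" "(g6 has_integral I g6) {0..1}"
    by (auto intro!: I continuous_intros assms simp: defs)
  show ?thesis
  proof (rule that[of "I g1" "I g2" "I g3" "I g4" "I g5" "I g6"])
    fix a0 b0 a1 b1 a2 b2 :: real
    have "((\<lambda>t. g1 t * a0 + g2 t * b0 + g3 t * a1 + g4 t * b1 + g5 t * a2 + g6 t * b2) has_integral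
        (I g1 * a0 + I g2 * b0 + I g3 * a1 + I g4 * b1 + I g5 * a2 + I g6 * b2)) {0..1}"
      by (intro has_integral_add has_integral_mult_left h)
    then show "((\<lambda>t. t * (2 * c t * ((b1 - a1) - m t * (b0 - a0))
        - (c t)\<^sup>2 * (((1 - t) * a2 + t * b2) - 2 * m t * ((1 - t) * a1 + t * b1)
                    + (m t)\<^sup>2 * ((1 - t) * a0 + t * b0))))
      has_integral (I g1 * a0 + I g2 * b0 + I g3 * a1 + I g4 * b1 + I g5 * a2 + I g6 * b2)) {0..1}"
      by (rule has_integral_eq[rotated]) (simp add: defs power2_eq_square algebra_simps)
  qed
qed

lemma segment_pos:
  fixes a b t :: real
  assumes "a > 0" "b > 0" "t \<in> {0..1}"
  shows "a + t * (b - a) > 0"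
proof -
  have "a + t * (b - a) = (1 - t) * a + t * b" by (simp add: algebra_simps)
  moreover have "(1 - t) * a + t * b > 0"
    using assms by (cases "t = 0") (auto intro!: add_nonneg_pos)
  ultimately show ?thesis by simp
qed

lemma has_integral_ln_ratio:
  fixes a b :: real
  assumes "a > 0" "b > 0"
  shows "((\<lambda>t. t * ((b - a)\<^sup>2 / (a + t * (b - a)))) has_integral (a * ln (a / b) + b - a)) {0..1}"
proof -
  \<comment> \<open>With r = a + t (b - a) one has t (b - a) = r - a, so the integrand is (b - a) -
    a (b - a) / r.\<close>
  define F where "F t = (b - a) * t - a * ln (a + t * (b - a))" for t
  have "((\<lambda>t. t * ((b - a)\<^sup>2 / (a + t * (b - a)))) has_integral (F 1 - F 0)) {0..1}"
  proof (rule fundamental_theorem_of_calculus)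
    fix t :: real assume "t \<in> {0..1}"
    then have r: "a + t * (b - a) > 0" using segment_pos assms by blast
    have "(F has_real_derivative (b - a) - a * ((b - a) / (a + t * (b - a)))) (at t within {0..1})"
      unfolding F_def using r by (auto intro!: derivative_eq_intros)
    moreover have "(b - a) - a * ((b - a) / (a + t * (b - a))) = t * ((b - a)\<^sup>2 / (a + t * (b - a)))"
      using r by (simp add: field_simps power2_eq_square)
    ultimately show "(F has_vector_derivative t * ((b - a)\<^sup>2 / (a + t * (b - a)))) (at t within {0..1})"
      by (simp add: has_real_derivative_iff_has_vector_derivative)
  qed simp
  also have "F 1 - F 0 = a * ln (a / b) + b - a"
    using assms by (simp add: F_def ln_div algebra_simps)
  finally show ?thesis .
qed

text \<open>Here \<open>a\<close>, \<open>b\<close>, \<open>y\<close> stand for p x, q x, f x at one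
  point. Completing the square turns the gap between the two sides into the integral of
  \<open>G\<close>. Since \<open>G\<close> is continuous and nonnegative, a zero gap leaves no
  exceptional t.\<close>

lemma tangent_form_integral_le:
  fixes c m :: "real \<Rightarrow> real" and a b y B :: real
  assumes "a > 0" "b > 0" and c: "continuous_on {0..1} c" and m: "continuous_on {0..1} m"
    and B: "((\<lambda>t. t * (2 * c t * ((b - a) * (y - m t)) - (c t)\<^sup>2 * ((y - m t)\<^sup>2 * (a + t * (b - a)))))
             has_integral B) {0..1}"
  shows "B \<le> a * ln (a / b) + b - a"
    and "B = a * ln (a / b) + b - a \<longleftrightarrow>
         (\<forall>t\<in>{0..1}. b - a = c t * (y - m t) * (a + t * (b - a)))"
proof -
  define e where "e t = b - a - c t * (y - m t) * (a + t * (b - a))" for t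
  define G where "G t = t * ((e t)\<^sup>2 / (a + t * (b - a)))" for t
  have r: "a + t * (b - a) > 0" if "t \<in> {0..1}" for t
    using segment_pos[OF assms(1,2) that] .
  have e: "continuous_on {0..1} e"
    unfolding e_def by (intro continuous_intros c m)
  have "continuous_on {0..1} G"
    unfolding G_def using r by (intro continuous_intros e ballI less_imp_neq[symmetric])
  have G0: "G t \<ge> 0" if "t \<in> {0..1}" for t
    using that r[OF that] by (simp add: G_def)
  have "((\<lambda>t. t * ((b - a)\<^sup>2 / (a + t * (b - a))) -
      t * (2 * c t * ((b - a) * (y - m t)) - (c t)\<^sup>2 * ((y - m t)\<^sup>2 * (a + t * (b - a)))))
      has_integral (a * ln (a / b) + b - a - B)) {0..1}"
    by (intro has_integral_diff has_integral_ln_ratio assms)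
  then have "(G has_integral (a * ln (a / b) + b - a - B)) {0..1}"
  proof (rule has_integral_eq[rotated])
    fix t :: real assume "t \<in> {0..1}"
    have sq: "u\<^sup>2 / s - (2 * k * (u * w) - k\<^sup>2 * (w\<^sup>2 * s)) = (u - k * w * s)\<^sup>2 / s"
      if "s > 0" for u s k w :: real
    proof -
      have "(u - k * w * s)\<^sup>2 = u\<^sup>2 - (2 * k * (u * w) - k\<^sup>2 * (w\<^sup>2 * s)) * s"
        by (simp add: power2_eq_square algebra_simps)
      with that show ?thesis by (simp add: diff_divide_distrib)
    qed
    show "t * ((b - a)\<^sup>2 / (a + t * (b - a))) -
        t * (2 * c t * ((b - a) * (y - m t)) - (c t)\<^sup>2 * ((y - m t)\<^sup>2 * (a + t * (b - a)))) = G t"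
      unfolding G_def e_def sq[OF r[OF \<open>t \<in> {0..1}\<close>], symmetric] by (simp only: right_diff_distrib)
  qed
  then have IG: "integral {0..1} G = a * ln (a / b) + b - a - B"
    by (rule integral_unique)
  show "B \<le> a * ln (a / b) + b - a"
    using has_integral_nonneg[OF \<open>(G has_integral _) _\<close> G0] by simp
  have "B = a * ln (a / b) + b - a \<longleftrightarrow> (\<forall>t\<in>{0..1}. G t = 0)"
    using integral_eq_0_iff[OF \<open>continuous_on {0..1} G\<close> _ G0] IG by auto
  also have "\<dots> \<longleftrightarrow> (\<forall>t\<in>{0<..1}. e t = 0)"
  proof -
    have "G t = 0 \<longleftrightarrow> t = 0 \<or> e t = 0" if "t \<in> {0..1}" for t
      using r[OF that] by (simp add: G_def)
    moreover have "t \<in> {0<..1} \<longleftrightarrow> t \<in> {0..1} \<and> t \<noteq> 0" for t :: real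
      by auto
    ultimately show ?thesis by blast
  qed
  \<comment> \<open>The weight t in \<open>G\<close> hides the value of \<open>e\<close> at 0, which
    is recovered by continuity.\<close>
  also have "\<dots> \<longleftrightarrow> (\<forall>t\<in>{0..1}. e t = 0)"
  proof -
    have "e t = 0" if "\<forall>t\<in>{0<..1}. e t = 0" "t \<in> {0..1}" for t
      by (rule continuous_constant_on_closure[of "{0<..1}"]) (use that e in simp_all)
    then show ?thesis by auto
  qed
  finally show "B = a * ln (a / b) + b - a \<longleftrightarrow>
      (\<forall>t\<in>{0..1}. b - a = c t * (y - m t) * (a + t * (b - a)))"
    by (simp add: e_def)
qed

section \<open>Comparison of integrals that may be infinite\<close>

text \<open>The integrable minorant \<open>g\<close> makes the negative part of \<open>h\<close>
  finite, so \<open>K\<close> is never infinity minus infinity. If the positive part is infinite,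
  the bound is strict and \<open>h\<close> cannot agree with \<open>g\<close> almost everywhere;
  otherwise \<open>h\<close> is integrable and the usual criterion for a vanishing integral of
  \<open>h - g\<close> applies.\<close>

lemma extended_integral_ge:
  fixes g h :: "'a \<Rightarrow> real"
  assumes h[measurable]: "h \<in> borel_measurable M" and g: "integrable M g"
    and le: "AE x in M. g x \<le> h x"
  defines "K \<equiv> enn2ereal (\<integral>\<^sup>+x. ennreal (h x) \<partial>M) - enn2ereal (\<integral>\<^sup>+x. ennreal (- h x) \<partial>M)"
  shows "ereal (LINT x|M. g x) \<le> K"
    and "K = ereal (LINT x|M. g x) \<longleftrightarrow> (AE x in M. h x = g x)"
proof -
  have gf: "(\<integral>\<^sup>+x. ennreal (g x) \<partial>M) \<noteq> \<infinity>" "(\<integral>\<^sup>+x. ennreal (- g x) \<partial>M) \<noteq> \<infinity>"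
    using g by (auto simp: real_integrable_def)
  have "(\<integral>\<^sup>+x. ennreal (- h x) \<partial>M) \<le> (\<integral>\<^sup>+x. ennreal (- g x) \<partial>M)"
    by (rule nn_integral_mono_AE) (use le in \<open>auto intro!: ennreal_leI\<close>)
  then have hm: "(\<integral>\<^sup>+x. ennreal (- h x) \<partial>M) \<noteq> \<infinity>"
    using gf(2) by (auto simp: top_unique)
  have "ereal (LINT x|M. g x) \<le> K \<and> (K = ereal (LINT x|M. g x) \<longleftrightarrow> (AE x in M. h x = g x))"
  proof (cases "(\<integral>\<^sup>+x. ennreal (h x) \<partial>M) = \<infinity>")
    case True
    have "K = \<infinity>"
      using True hm unfolding K_def
      by (cases "\<integral>\<^sup>+x. ennreal (- h x) \<partial>M") (auto simp: enn2ereal_ennreal)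
    moreover have "\<not> (AE x in M. h x = g x)"
    proof
      assume "AE x in M. h x = g x"
      then have "(\<integral>\<^sup>+x. ennreal (h x) \<partial>M) = (\<integral>\<^sup>+x. ennreal (g x) \<partial>M)"
        by (intro nn_integral_cong_AE) auto
      with True gf show False by simp
    qed
    ultimately show ?thesis by simp
  next
    case False
    then have hi: "integrable M h" using hm by (simp add: real_integrable_def)
    have K: "K = ereal (LINT x|M. h x)"
      using False hm unfolding K_def real_lebesgue_integral_def[OF hi]
      by (cases "\<integral>\<^sup>+x. ennreal (- h x) \<partial>M"; cases "\<integral>\<^sup>+x. ennreal (h x) \<partial>M")
        (auto simp: enn2ereal_ennreal)
    have "(LINT x|M. h x - g x) = 0 \<longleftrightarrow> (AE x in M. h x - g x = 0)"
      by (rule integral_nonneg_eq_0_iff_AE) (use hi g le in auto)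
    then show ?thesis
      using integral_mono_AE[OF g hi le] hi g by (simp add: K)
  qed
  then show "ereal (LINT x|M. g x) \<le> K"
    and "K = ereal (LINT x|M. g x) \<longleftrightarrow> (AE x in M. h x = g x)"
    by auto
qed

section \<open>Moments of the mixtures and the closed form of the bound\<close>

locale two_moments =
  fixes mP mQ vP vQ :: real
  assumes vP: "vP > 0" and vQ: "vQ > 0"
begin

definition m :: "real \<Rightarrow> real" where
  "m t = mP + t * (mQ - mP)"

text \<open>By the law of total variance the mixture has variance (1 - t) vP + t vQ + t (1 - t) (mQ
  - mP)^2. It is expanded in powers of t to expose a quadratic polynomial.\<close>

definition v :: "real \<Rightarrow> real" where
  "v t = vP + t * (vQ - vP + (mQ - mP)\<^sup>2) - t\<^sup>2 * (mQ - mP)\<^sup>2"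

definition c :: "real \<Rightarrow> real" where
  "c t = (mQ - mP) / v t"

definition A :: real where
  "A = (mQ - mP)\<^sup>2 + vP + vQ"

definition D :: real where
  "D = sqrt (A\<^sup>2 - 4 * vP * vQ)"

definition bound :: real where
  "bound = (if D = 0 then 0 else (A - 2 * vP) / D * artanh (D / A)) + 1 / 2 * ln (vP / vQ)"

lemma v_pos:
  assumes "t \<in> {0..1}"
  shows "v t > 0"
proof -
  have "v t = (vP + t * (vQ - vP)) + t * (1 - t) * (mQ - mP)\<^sup>2"
    by (simp add: v_def power2_eq_square algebra_simps)
  moreover have "t * (1 - t) * (mQ - mP)\<^sup>2 \<ge> 0"
    using assms by simp
  ultimately show ?thesis
    using segment_pos[OF vP vQ assms] by linarith
qed

lemma continuous_m: "continuous_on {0..1} m"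
  unfolding m_def by (intro continuous_intros)

lemma continuous_c: "continuous_on {0..1} c"
proof -
  have "continuous_on {0..1} v" unfolding v_def by (intro continuous_intros)
  then show ?thesis
    unfolding c_def using v_pos by (intro continuous_intros) force+
qed

text \<open>The linear coefficient of \<open>v\<close> is \<open>A - 2 * vP\<close>, so the
  right-hand side is the discriminant of \<open>v\<close>. It is nonnegative, hence \<open>D\<close>
  is a genuine square root.\<close>

lemma D_squared: "A\<^sup>2 - 4 * vP * vQ = (A - 2 * vP)\<^sup>2 + 4 * vP * (mQ - mP)\<^sup>2"
  by (simp add: A_def power2_eq_square algebra_simps)

lemma D_power2: "D\<^sup>2 = (A - 2 * vP)\<^sup>2 + 4 * vP * (mQ - mP)\<^sup>2"
  unfolding D_def D_squared using vP by simp

text \<open>With b the linear coefficient of \<open>v\<close> and d = (mQ - mP)^2, the integrand t d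
  / v splits as b / (2 v) - v' / (2 v). The first term integrates to an \<open>artanh\<close>
  because \<open>D\<close> is the root of the discriminant, the second to a logarithm. At t = 1 the
  argument of \<open>artanh\<close> becomes D / A.\<close>

lemma has_integral_bound:
  "((\<lambda>t. t * ((mQ - mP)\<^sup>2 / v t)) has_integral bound) {0..1}"
proof -
  define b where "b = A - 2 * vP"
  define \<delta> where "\<delta> = (mQ - mP)\<^sup>2"
  \<comment> \<open>\<open>D = 0\<close> forces \<open>b = 0\<close>, so the junk value of \<open>b / D\<close> is harmless.\<close>
  define F where "F t = b / D * artanh (D * t / (2 * vP + b * t)) - ln (v t) / 2" for t
  have \<delta>: "\<delta> \<ge> 0" by (simp add: \<delta>_def)
  have b: "b = vQ - vP + \<delta>" by (simp add: b_def A_def \<delta>_def)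
  have v: "v t = vP + b * t - \<delta> * t\<^sup>2" for t by (simp add: v_def b \<delta>_def algebra_simps)
  have DD: "D\<^sup>2 = b\<^sup>2 + 4 * vP * \<delta>" using D_power2 by (simp add: b_def \<delta>_def)
  then have Db: "b = 0" if "D = 0"
    using that vP \<delta> by (simp add: add_nonneg_eq_0_iff)
  have "((\<lambda>t. t * (\<delta> / v t)) has_integral (F 1 - F 0)) {0..1}"
  proof (rule fundamental_theorem_of_calculus)
    fix t :: real assume t: "t \<in> {0..1}"
    define w where "w = 2 * vP + b * t"
    have "w = vP + (vP + t * (vQ - vP)) + \<delta> * t"
      by (simp add: w_def b algebra_simps)
    with segment_pos[OF vP vQ t] \<delta> t vP have w: "w > 0"
      by (smt (verit) atLeastAtMost_iff mult_nonneg_nonneg)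
    have vt: "v t > 0" using v_pos[OF t] .
    \<comment> \<open>This identity reduces the domain condition of \<open>artanh\<close> to the
      positivity of \<open>v t\<close>, and also simplifies the derivative.\<close>
    have "w\<^sup>2 - (D * t)\<^sup>2 = 4 * vP * v t"
      unfolding power_mult_distrib DD by (simp add: w_def v power2_eq_square algebra_simps)
    then have 1: "1 - (D * t / w)\<^sup>2 = 4 * vP * v t / w\<^sup>2"
      using w by (simp add: power_divide diff_divide_distrib[symmetric] divide_simps)
    have "4 * vP * v t / w\<^sup>2 > 0" using vP vt w by simp
    with 1 have "(D * t / w)\<^sup>2 < 1" by linarith
    then have abs: "\<bar>D * t / w\<bar> < 1" by (simp add: abs_square_less_1)
    have u: "((\<lambda>t. D * t / (2 * vP + b * t)) has_real_derivative 2 * vP * D / w\<^sup>2) (at t within {0..1})"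
      using w unfolding w_def
      by (auto intro!: derivative_eq_intros simp: power2_eq_square field_simps)
    have "((\<lambda>t. artanh (D * t / (2 * vP + b * t))) has_real_derivative
        1 / (1 - (D * t / w)\<^sup>2) * (2 * vP * D / w\<^sup>2)) (at t within {0..1})"
      using DERIV_chain2[OF artanh_real_has_field_derivative u] abs unfolding w_def by auto
    also have "1 / (1 - (D * t / w)\<^sup>2) * (2 * vP * D / w\<^sup>2) = D / (2 * v t)"
      unfolding 1 using w vP vt by (simp add: field_simps)
    finally have art: "((\<lambda>t. artanh (D * t / (2 * vP + b * t))) has_real_derivative
        D / (2 * v t)) (at t within {0..1})" .
    have lnv: "((\<lambda>t. ln (v t) / 2) has_real_derivative (b - 2 * \<delta> * t) / (2 * v t)) (at t within {0..1})"
      using vt unfolding v by (auto intro!: derivative_eq_intros simp: field_simps)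
    have "(F has_real_derivative b / D * (D / (2 * v t)) - (b - 2 * \<delta> * t) / (2 * v t))
        (at t within {0..1})"
      unfolding F_def by (intro DERIV_diff DERIV_cmult art lnv)
    moreover have "b / D * (D / (2 * v t)) - (b - 2 * \<delta> * t) / (2 * v t) = t * (\<delta> / v t)"
      using Db vt by (cases "D = 0") (simp_all add: field_simps)
    ultimately show "(F has_vector_derivative t * (\<delta> / v t)) (at t within {0..1})"
      by (simp add: has_real_derivative_iff_has_vector_derivative)
  qed simp
  also have "F 1 - F 0 = bound"
  proof -
    have "v 1 = vQ" "v 0 = vP" "2 * vP + b = A" by (simp_all add: v b A_def \<delta>_def)
    then show ?thesis
      using vP vQ by (simp add: F_def bound_def ln_div b_def)
  qed
  finally show ?thesis unfolding \<delta>_def .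
qed

end

section \<open>Divergence bound on an abstract measure space\<close>

text \<open>Stating the moments through \<open>has_bochner_integral\<close> keeps integrability and
  value together, so linearity transports both at once.\<close>

locale moment_densities = two_moments +
  fixes M :: "'a measure" and p q f :: "'a \<Rightarrow> real"
  assumes meas [measurable]: "p \<in> borel_measurable M" "q \<in> borel_measurable M" "f \<in> borel_measurable M"
    and pos: "AE x in M. p x > 0" "AE x in M. q x > 0"
    and p0: "has_bochner_integral M p 1"
    and q0: "has_bochner_integral M q 1"
    and p1: "has_bochner_integral M (\<lambda>x. p x * f x) mP"
    and q1: "has_bochner_integral M (\<lambda>x. q x * f x) mQ"
    and p2: "has_bochner_integral M (\<lambda>x. p x * (f x)\<^sup>2) (vP + mP\<^sup>2)"
    and q2: "has_bochner_integral M (\<lambda>x. q x * (f x)\<^sup>2) (vQ + mQ\<^sup>2)"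
begin

lemma covariance_integral:
  "has_bochner_integral M (\<lambda>x. (q x - p x) * (f x - m t)) (mQ - mP)"
proof -
  have "has_bochner_integral M (\<lambda>x. q x * f x - p x * f x - m t * (q x - p x)) (mQ - mP - m t * (1 - 1))"
    by (intro has_bochner_integral_diff has_bochner_integral_mult_right p0 q0 p1 q1)
  then show ?thesis by (simp add: algebra_simps)
qed

lemma variance_integral:
  "has_bochner_integral M (\<lambda>x. (f x - m t)\<^sup>2 * (p x + t * (q x - p x))) (v t)"
proof -
  have "has_bochner_integral M (\<lambda>x. ((1 - t) * (p x * (f x)\<^sup>2) + t * (q x * (f x)\<^sup>2))
      - 2 * m t * ((1 - t) * (p x * f x) + t * (q x * f x)) + (m t)\<^sup>2 * ((1 - t) * p x + t * q x))
      (((1 - t) * (vP + mP\<^sup>2) + t * (vQ + mQ\<^sup>2))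
      - 2 * m t * ((1 - t) * mP + t * mQ) + (m t)\<^sup>2 * ((1 - t) * 1 + t * 1))"
    by (intro has_bochner_integral_diff has_bochner_integral_add has_bochner_integral_mult_right
        p0 q0 p1 q1 p2 q2)
  then show ?thesis
    by (simp add: m_def v_def power2_eq_square algebra_simps)
qed

text \<open>Multiplying the relation by (f - m_t) r_t and integrating gives mQ - mP = C v_t. Thus an
  arbitrary \<open>C\<close> in the equality condition is forced to be \<open>c\<close>, which is
  continuous.\<close>

lemma linear_relation_slope:
  assumes "t \<in> {0..1}" and "AE x in M. (q x - p x) / (p x + t * (q x - p x)) = (f x - m t) * C"
  shows "C = c t"
proof -
  have "AE x in M. (q x - p x) * (f x - m t) = C * ((f x - m t)\<^sup>2 * (p x + t * (q x - p x)))"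
    using assms(2) pos
  proof eventually_elim
    case (elim x)
    from segment_pos[OF elim(2,3) assms(1)] elim(1)
    have "q x - p x = (f x - m t) * C * (p x + t * (q x - p x))"
      by (simp add: nonzero_divide_eq_eq)
    then have "(q x - p x) * (f x - m t) = (f x - m t) * C * (p x + t * (q x - p x)) * (f x - m t)"
      by (rule arg_cong)
    also have "\<dots> = C * ((f x - m t)\<^sup>2 * (p x + t * (q x - p x)))"
      by (simp only: power2_eq_square ac_simps)
    finally show ?case .
  qed
  then have "(LINT x|M. (q x - p x) * (f x - m t)) =
      (LINT x|M. C * ((f x - m t)\<^sup>2 * (p x + t * (q x - p x))))"
    by (intro integral_cong_AE) auto
  then have "mQ - mP = C * v t"
    using covariance_integral[of t] variance_integral[of t]
    by (simp add: has_bochner_integral_integral_eq)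
  then show ?thesis using v_pos[OF assms(1)] by (simp add: c_def)
qed

text \<open>On the left the null set may depend on t, on the right it may not. Countably many null
  sets are united over a dense set of t; once the denominator is cleared, continuity in t extends
  the identity to the whole interval.\<close>

lemma linear_relation_iff:
  "(\<exists>C. \<forall>t\<in>{0..1}. AE x in M. (q x - p x) / (p x + t * (q x - p x)) = (f x - m t) * C t) \<longleftrightarrow>
   (AE x in M. \<forall>t\<in>{0..1}. q x - p x = c t * (f x - m t) * (p x + t * (q x - p x)))"
    (is "?L \<longleftrightarrow> ?R")
proof
  assume ?L
  then obtain C where C: "\<And>t. t \<in> {0..1} \<Longrightarrow>
      AE x in M. (q x - p x) / (p x + t * (q x - p x)) = (f x - m t) * C t" by blast
  \<comment> \<open>Rationals of the open interval: countable, yet with closure containing both end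
    points.\<close>
  define S :: "real set" where "S = {0<..<1} \<inter> \<rat>"
  have "countable S" unfolding S_def by (simp add: countable_rat)
  have closure_S: "closure S = {0..1}"
    unfolding S_def by (subst closure_open_Int_superset) (auto simp: Rats_closure_real)
  have "AE x in M. (q x - p x) / (p x + t * (q x - p x)) = (f x - m t) * c t" if "t \<in> S" for t
    using C linear_relation_slope[OF _ C] that by (auto simp: S_def)
  then have "AE x in M. \<forall>t\<in>S. (q x - p x) / (p x + t * (q x - p x)) = (f x - m t) * c t"
    by (simp add: AE_ball_countable[OF \<open>countable S\<close>])
  then show ?R
    using pos
  proof eventually_elim
    case (elim x)
    define e where "e t = q x - p x - c t * (f x - m t) * (p x + t * (q x - p x))" for t
    have "e t = 0" if "t \<in> S" for t
    proof -
      have "p x + t * (q x - p x) > 0"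
        using segment_pos[OF elim(2,3), of t] that by (simp add: S_def)
      moreover have "(q x - p x) / (p x + t * (q x - p x)) = (f x - m t) * c t"
        using elim(1) that by blast
      ultimately show ?thesis by (simp add: e_def nonzero_divide_eq_eq ac_simps)
    qed
    moreover have "continuous_on (closure S) e"
      unfolding closure_S e_def by (intro continuous_intros continuous_c continuous_m)
    ultimately have "e t = 0" if "t \<in> {0..1}" for t
      using continuous_constant_on_closure[of S e 0 t] that by (simp add: closure_S)
    then show ?case by (simp add: e_def)
  qed
next
  assume R: ?R
  have "AE x in M. (q x - p x) / (p x + t * (q x - p x)) = (f x - m t) * c t" if t: "t \<in> {0..1}" for t
    using R pos
  proof eventually_elim
    case (elim x)
    have "q x - p x = c t * (f x - m t) * (p x + t * (q x - p x))"
      using elim(1) t by blast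
    with segment_pos[OF elim(2,3) t] show ?case by (simp add: nonzero_divide_eq_eq ac_simps)
  qed
  then show ?L by blast
qed

lemma divergence_ge_bound:
  defines "K \<equiv> enn2ereal (\<integral>\<^sup>+x. ennreal (p x * ln (p x / q x)) \<partial>M)
             - enn2ereal (\<integral>\<^sup>+x. ennreal (- (p x * ln (p x / q x))) \<partial>M)"
  shows "ereal bound \<le> K"
    and "K = ereal bound \<longleftrightarrow>
      (\<exists>C. \<forall>t\<in>{0..1}. AE x in M. (q x - p x) / (p x + t * (q x - p x)) = (f x - m t) * C t)"
proof -
  obtain k0 l0 k1 l1 k2 l2 where k: "\<And>a0 b0 a1 b1 a2 b2.
    ((\<lambda>t. t * (2 * c t * ((b1 - a1) - m t * (b0 - a0))
        - (c t)\<^sup>2 * (((1 - t) * a2 + t * b2) - 2 * m t * ((1 - t) * a1 + t * b1)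
                    + (m t)\<^sup>2 * ((1 - t) * a0 + t * b0))))
      has_integral (k0 * a0 + l0 * b0 + k1 * a1 + l1 * b1 + k2 * a2 + l2 * b2)) {0..1}"
    by (rule has_integral_tangent_form[OF continuous_c continuous_m]) (blast intro: that)
  \<comment> \<open>The integral over t of the tangent form at x, visibly a combination of six
    integrable functions.\<close>
  define B where "B x = k0 * p x + l0 * q x + k1 * (p x * f x) + l1 * (q x * f x)
      + k2 * (p x * (f x)\<^sup>2) + l2 * (q x * (f x)\<^sup>2)" for x
  have B: "((\<lambda>t. t * (2 * c t * ((q x - p x) * (f x - m t))
      - (c t)\<^sup>2 * ((f x - m t)\<^sup>2 * (p x + t * (q x - p x))))) has_integral B x) {0..1}" for x
    unfolding B_def
    by (rule has_integral_eq[OF _ k]) (simp add: power2_eq_square algebra_simps)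
  have "has_bochner_integral M B
      (k0 * 1 + l0 * 1 + k1 * mP + l1 * mQ + k2 * (vP + mP\<^sup>2) + l2 * (vQ + mQ\<^sup>2))"
    unfolding B_def
    by (intro has_bochner_integral_add has_bochner_integral_mult_right p0 q0 p1 q1 p2 q2)
  \<comment> \<open>The coefficients are now applied to the moments. There the tangent form becomes
    2 c (mQ - mP) - c^2 v = (mQ - mP)^2 / v, and uniqueness of the integral over t identifies the
    value.\<close>
  also have "k0 * 1 + l0 * 1 + k1 * mP + l1 * mQ + k2 * (vP + mP\<^sup>2) + l2 * (vQ + mQ\<^sup>2) = bound"
  proof (rule has_integral_unique[OF _ has_integral_bound])
    show "((\<lambda>t. t * ((mQ - mP)\<^sup>2 / v t)) has_integral
        (k0 * 1 + l0 * 1 + k1 * mP + l1 * mQ + k2 * (vP + mP\<^sup>2) + l2 * (vQ + mQ\<^sup>2))) {0..1}"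
    proof (rule has_integral_eq[OF _ k])
      fix t :: real assume "t \<in> {0..1}"
      then have "v t > 0" by (rule v_pos)
      have "((1 - t) * (vP + mP\<^sup>2) + t * (vQ + mQ\<^sup>2)) - 2 * m t * ((1 - t) * mP + t * mQ)
          + (m t)\<^sup>2 * ((1 - t) * 1 + t * 1) = v t"
        by (simp add: m_def v_def power2_eq_square algebra_simps)
      moreover have "2 * c t * ((mQ - mP) - m t * (1 - 1)) - (c t)\<^sup>2 * v t = (mQ - mP)\<^sup>2 / v t"
        using \<open>v t > 0\<close> by (simp add: c_def field_simps power2_eq_square)
      ultimately show "t * (2 * c t * ((mQ - mP) - m t * (1 - 1))
        - (c t)\<^sup>2 * (((1 - t) * (vP + mP\<^sup>2) + t * (vQ + mQ\<^sup>2)) - 2 * m t * ((1 - t) * mP + t * mQ)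
                    + (m t)\<^sup>2 * ((1 - t) * 1 + t * 1))) = t * ((mQ - mP)\<^sup>2 / v t)"
        by simp
    qed
  qed
  \<comment> \<open>The pointwise bound concerns p ln (p / q) + q - p; moving q - p across costs
    nothing, as both densities have mass 1.\<close>
  finally have "has_bochner_integral M (\<lambda>x. B x + (p x - q x)) (bound + (1 - 1))"
    by (intro has_bochner_integral_add has_bochner_integral_diff p0 q0)
  then have g: "integrable M (\<lambda>x. B x + (p x - q x))"
    and Lg: "(LINT x|M. B x + (p x - q x)) = bound"
    by (simp_all add: has_bochner_integral_iff)
  have le: "AE x in M. B x + (p x - q x) \<le> p x * ln (p x / q x)"
    using pos
  proof eventually_elim
    case (elim x)
    show ?case using tangent_form_integral_le(1)[OF elim continuous_c continuous_m B] by simp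
  qed
  have eq: "(AE x in M. p x * ln (p x / q x) = B x + (p x - q x)) \<longleftrightarrow>
      (AE x in M. \<forall>t\<in>{0..1}. q x - p x = c t * (f x - m t) * (p x + t * (q x - p x)))"
  proof (rule eventually_subst)
    show "AE x in M. (p x * ln (p x / q x) = B x + (p x - q x)) \<longleftrightarrow>
      (\<forall>t\<in>{0..1}. q x - p x = c t * (f x - m t) * (p x + t * (q x - p x)))"
      using pos
    proof eventually_elim
      case (elim x)
      show ?case
        unfolding tangent_form_integral_le(2)[OF elim continuous_c continuous_m B, symmetric] by auto
    qed
  qed
  have h: "(\<lambda>x. p x * ln (p x / q x)) \<in> borel_measurable M" by measurable
  show "ereal bound \<le> K"
    using extended_integral_ge(1)[OF h g le] by (simp add: K_def Lg)
  show "K = ereal bound \<longleftrightarrow>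
      (\<exists>C. \<forall>t\<in>{0..1}. AE x in M. (q x - p x) / (p x + t * (q x - p x)) = (f x - m t) * C t)"
    unfolding linear_relation_iff eq[symmetric] K_def
    using extended_integral_ge(2)[OF h g le] by (simp add: Lg)
qed

end

section \<open>Transfer to distributions with a common support\<close>

text \<open>Since \<open>P\<close> is concentrated on the support, restricting the density there
  loses no mass.\<close>

lemma density_integral_eq_one:
  assumes "distribution_with_density lam P p" "has_support lam P p \<omega>" "\<omega> \<inter> space lam \<in> sets lam"
    and "AE x in restrict_space lam \<omega>. p x > 0"
  shows "has_bochner_integral (restrict_space lam \<omega>) p 1"
proof (rule has_bochner_integral_nn_integral)
  interpret P: prob_space P using assms(1) unfolding distribution_with_density_def by blast
  have P: "P = density lam (\<lambda>x. ennreal (p x))" and p[measurable]: "p \<in> borel_measurable lam"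
    using assms(1) by (auto simp: distribution_with_density_def)
  have \<omega>: "\<omega> \<in> sets lam" "AE x in P. x \<in> \<omega>" using assms(2) by (auto simp: has_support_def)
  show "p \<in> borel_measurable (restrict_space lam \<omega>)" by (rule measurable_restrict_space1) fact
  show "AE x in restrict_space lam \<omega>. 0 \<le> p x" using assms(4) by eventually_elim simp
  have "emeasure P \<omega> = 1"
    using \<omega> by (intro P.emeasure_eq_1_AE) (simp_all add: P)
  then show "(\<integral>\<^sup>+x. ennreal (p x) \<partial>restrict_space lam \<omega>) = ennreal 1"
    using \<omega>(1) assms(3) by (simp add: P emeasure_density nn_integral_restrict_space)
qed simp

theorem theorem1:
  fixes lam P Q :: "(real ^ 'n) measure"
    and \<omega> :: "(real ^ 'n) set"
    and p q f :: "real ^ 'n \<Rightarrow> real"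
    and E_P E_Q V_P V_Q A D :: real
  assumes "reference_measure lam"
    and "distribution_with_density lam P p"
    and "distribution_with_density lam Q q"
    and "has_support lam P p \<omega>"
    and "has_support lam Q q \<omega>"
    and "set_borel_measurable lam \<omega> f"
    and "finite_mean_var lam \<omega> p f"
    and "finite_mean_var lam \<omega> q f"
    and "E_P = mean lam \<omega> p f"
    and "E_Q = mean lam \<omega> q f"
    and "V_P = var lam \<omega> p f"
    and "V_Q = var lam \<omega> q f"
    and "V_P > 0"
    and "V_Q > 0"
    and "A = (E_Q - E_P)\<^sup>2 + V_P + V_Q"
    and "D = sqrt (A\<^sup>2 - 4 * V_P * V_Q)"
  shows "KL lam \<omega> p q \<ge>
           ereal ((if D = 0 then 0 else (A - 2 * V_P) / D * artanh (D / A)) + 1 / 2 * ln (V_P / V_Q))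
       \<and> (KL lam \<omega> p q =
           ereal ((if D = 0 then 0 else (A - 2 * V_P) / D * artanh (D / A)) + 1 / 2 * ln (V_P / V_Q))
          \<longleftrightarrow> (\<exists>C :: real \<Rightarrow> real. \<forall>t\<in>{0..1}. AE x\<in>\<omega> in lam.
                (q x - p x) / (p x + t * (q x - p x)) = (f x - E_P - t * (E_Q - E_P)) * C t))"
proof -
  note defs = distribution_with_density_def has_support_def finite_mean_var_def mean_def var_def
    set_integrable_def set_lebesgue_integral_def
  let ?M = "restrict_space lam \<omega>"
  have "\<omega> \<in> sets lam" using assms(4) by (simp add: has_support_def)
  then have \<omega>: "\<omega> \<inter> space lam \<in> sets lam" by simp
  have pos: "AE x in ?M. p x > 0" "AE x in ?M. q x > 0"
    using assms(4,5) by (simp_all add: has_support_def AE_restrict_space_iff[OF \<omega>])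
  \<comment> \<open>On the restricted space the set integrals become plain integrals, and
    \<open>f\<close>, assumed measurable only on the support, is measurable outright.\<close>
  interpret moment_densities E_P E_Q V_P V_Q ?M p q f
  proof
    show "p \<in> borel_measurable ?M" "q \<in> borel_measurable ?M"
      using assms(2,3) by (auto simp: distribution_with_density_def intro: measurable_restrict_space1)
    show "f \<in> borel_measurable ?M"
      using assms(6) by (simp add: set_borel_measurable_def borel_measurable_restrict_space_iff[OF \<omega>])
    show "has_bochner_integral ?M p 1" "has_bochner_integral ?M q 1"
      using density_integral_eq_one[OF assms(2,4) \<omega> pos(1)]
        density_integral_eq_one[OF assms(3,5) \<omega> pos(2)] by auto
  qed (use assms pos in \<open>simp_all add: has_bochner_integral_iff integrable_restrict_space[OF \<omega>]
      integral_restrict_space[OF \<omega>] defs\<close>)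
  have KL: "KL lam \<omega> p q = enn2ereal (\<integral>\<^sup>+x. ennreal (p x * ln (p x / q x)) \<partial>?M)
      - enn2ereal (\<integral>\<^sup>+x. ennreal (- (p x * ln (p x / q x))) \<partial>?M)"
    by (simp add: KL_def nn_integral_restrict_space[OF \<omega>])
  have bound: "(if D = 0 then 0 else (A - 2 * V_P) / D * artanh (D / A)) + 1 / 2 * ln (V_P / V_Q) = bound"
    unfolding bound_def D_def A_def assms(15,16) ..
  have iff: "(\<exists>C. \<forall>t\<in>{0..1}. AE x in ?M.
        (q x - p x) / (p x + t * (q x - p x)) = (f x - m t) * C t) \<longleftrightarrow>
      (\<exists>C. \<forall>t\<in>{0..1}. AE x\<in>\<omega> in lam.
        (q x - p x) / (p x + t * (q x - p x)) = (f x - E_P - t * (E_Q - E_P)) * C t)"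
    unfolding AE_restrict_space_iff[OF \<omega>] m_def diff_diff_eq ..
  show ?thesis
    unfolding bound KL iff[symmetric] using divergence_ge_bound by blast
qed

end
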